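(* No local field is rootless, and therefore no local field is of good heredity.
   Context: Local fields include the archimedean ones $\mathbb{R}$ and $\mathbb{C}$ and all non-archimedean local fields of any characteristic. Let $F$ be a field with algebraic closure $F^{alg}$. A polynomial $P \in F[x]$ is hereditarily irreducible over $F$ if for every integer $n\ge 1$ the polynomial $P(x^n)$ is irreducible over $F$. A polynomial $P\in F[x]$ has good heredity (over $F$) if for some integer $n \geq 1$ the polynomial $P(x^n)$ factors (up to a nonzero constant) as a product of polynomials in $F[x]$ that are hereditarily irreducible over $F$. The field $F$ has good heredity if every polynomial $P \in F[x]$, none of whose roots in $F^{alg}$ is zero or a root of unity, has good heredity over $F$. An element $a \in F$ that is not a root of unity is rootless (in $F$) if for all but finitely many integers $n\ge 1$ the equation $x^n = a$ has no solution in $F$. The field $F$ is rootless if every nonzero $f \in F$ that is not a root of unity is rootless in $F$. *)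

theory Defs
  imports
    "HOL-Analysis.Analysis"
    "HOL-Algebra.Algebraic_Closure_Type"
begin

text \<open>Roots of unity are needed both in a field and in its algebraic closure.\<close>

definition root_of_unity :: "'a::field \<Rightarrow> bool" where
  "root_of_unity a \<longleftrightarrow> (\<exists>n\<ge>1::nat. a ^ n = 1)"

text \<open>The qualified name selects irreducibility in the type class of rings; HOL-Algebra has a
  constant with the same base name for explicit carriers.\<close>

definition hereditarily_irreducible :: "'a::field poly \<Rightarrow> bool" where
  "hereditarily_irreducible P \<longleftrightarrow>
     (\<forall>n\<ge>1::nat. Factorial_Ring.irreducible (pcompose P (Polynomial.monom 1 n)))"

definition good_heredity_poly :: "'a::field poly \<Rightarrow> bool" where
  "good_heredity_poly P \<longleftrightarrow>
     (\<exists>n\<ge>1::nat. \<exists>c qs. c \<noteq> 0 \<and> (\<forall>q\<in>set qs. hereditarily_irreducible q) \<and>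
        pcompose P (Polynomial.monom 1 n) = Polynomial.smult c (prod_list qs))"

text \<open>The zero polynomial does not meet the condition on the roots, since it vanishes at 0.
  A nonzero constant polynomial does, and it has good heredity by way of the empty product.\<close>

definition good_heredity_field :: "'a::field itself \<Rightarrow> bool" where
  "good_heredity_field _ \<longleftrightarrow>
     (\<forall>P :: 'a poly.
        (\<forall>z :: 'a alg_closure. poly (map_poly to_ac P) z = 0 \<longrightarrow> z \<noteq> 0 \<and> \<not> root_of_unity z)
        \<longrightarrow> good_heredity_poly P)"

definition rootless :: "'a::field \<Rightarrow> bool" where
  "rootless a \<longleftrightarrow> \<not> root_of_unity a \<and> finite {n::nat. n \<ge> 1 \<and> (\<exists>x. x ^ n = a)}"

definition rootless_field :: "'a::field itself \<Rightarrow> bool" where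
  "rootless_field _ \<longleftrightarrow> (\<forall>a :: 'a. a \<noteq> 0 \<and> \<not> root_of_unity a \<longrightarrow> rootless a)"

text \<open>A local field is a field with a nontrivial absolute value that is locally compact in the
  induced topology. Up to equivalence of absolute values these are the real field, the complex
  field, and the fields complete under a discrete valuation with finite residue field, in any
  characteristic.\<close>

locale absolute_value =
  fixes v :: "'a::field \<Rightarrow> real"
  assumes nonneg: "v x \<ge> 0"
    and eq_0_iff: "v x = 0 \<longleftrightarrow> x = 0"
    and mult: "v (x * y) = v x * v y"
    and triangle: "v (x + y) \<le> v x + v y"

locale local_field = absolute_value v for v :: "'a::field \<Rightarrow> real" +
  assumes nontrivial: "\<exists>x. x \<noteq> 0 \<and> v x \<noteq> 1"
    and locally_compact:
      "locally_compact_space (Metric_space.mtopology UNIV (\<lambda>x y. v (x - y)))"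

lemma (in absolute_value) Metric_space_absolute_value:
  "Metric_space UNIV (\<lambda>x y. v (x - y))"
proof
  fix x y z :: 'a
  have "v (1::'a) * v 1 = v 1" "v (1::'a) \<noteq> 0"
    using mult[of 1 1] eq_0_iff[of 1] by simp_all
  hence 1: "v (1::'a) = 1" by simp
  have "v (- 1 :: 'a) * v (- 1) = 1"
    using mult[of "- 1" "- 1"] 1 by simp
  with nonneg[of "- 1"] have "v (- 1 :: 'a) = 1"
    by (smt (verit) mult_cancel_left1 mult_le_cancel_left_pos mult_less_cancel_left_pos)
  thus "v (x - y) = v (y - x)"
    using mult[of "- 1" "y - x"] by simp
  show "v (x - z) \<le> v (x - y) + v (y - z)"
    using triangle[of "x - y" "y - z"] by simp
qed (use nonneg eq_0_iff in auto)

lemma local_field_norm: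
  "local_field (norm :: 'a::{real_normed_field, heine_borel} \<Rightarrow> real)"
proof
  have "locally_compact_space (euclidean :: 'a topology)"
    unfolding locally_compact_space_def
  proof
    fix x :: 'a
    show "\<exists>U K. openin euclidean U \<and> compactin euclidean K \<and> x \<in> U \<and> U \<subseteq> K"
      by (rule exI[of _ "ball x 1"], rule exI[of _ "cball x 1"]) auto
  qed
  thus "locally_compact_space (Metric_space.mtopology UNIV (\<lambda>x y :: 'a. norm (x - y)))"
    using mtopology_is_euclidean[where ?'a = 'a] by (simp add: dist_norm[abs_def])
  show "\<exists>x::'a. x \<noteq> 0 \<and> norm x \<noteq> 1"
    by (rule exI[of _ 2]) simp
qed (auto simp: norm_mult norm_triangle_ineq)

lemma local_field_real: "local_field (abs :: real \<Rightarrow> real)"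
  using local_field_norm[where ?'a = real] by (simp add: real_norm_def[abs_def])

lemma local_field_complex: "local_field (norm :: complex \<Rightarrow> real)"
  by (rule local_field_norm)

end

theory Submission
  imports Defs
begin

text \<open>Good heredity implies rootlessness, over every field. Let \<open>a\<close> be neither zero nor a root of
  unity, and let \<open>x\<^sup>n - a\<close> be, up to a nonzero constant, a product of hereditarily irreducible
  polynomials \<open>q\<close>. If \<open>a = b\<^sup>m\<close>, then \<open>x\<^sup>n - b\<close> divides \<open>(x\<^sup>n)\<^sup>m - b\<^sup>m\<close>, which is a constant times the
  product of the irreducible polynomials \<open>q(x\<^sup>m)\<close>, each of degree at least \<open>m\<close>. A divisor of degree
  \<open>n \<ge> 1\<close> can only exist if \<open>m \<le> n\<close>, so \<open>a\<close> is an \<open>m\<close>-th power for finitely many \<open>m\<close> only. It thus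
  suffices to find, in a local field, a nonzero element that is not a root of unity and is an
  \<open>m\<close>-th power for infinitely many \<open>m\<close>.

  For a suitable exponent \<open>l \<ge> 2\<close>, every element of a small ball around 1 has an \<open>l\<close>-th
  root in the same ball, hence an \<open>l\<^sup>k\<close>-th root for every \<open>k\<close>. The root is the limit of a Newton
  iteration with fixed slope \<open>l\<close>, which is a contraction of a compact ball in two cases.
  \<^item> If \<open>\<bar>2\<bar> > 1\<close> (the archimedean case), \<open>l = 2\<close> works: the error term \<open>y\<^sup>2\<close> of the linear
    approximation is divided by 2, which is what makes the map a contraction on a small ball.
  \<^item> If \<open>\<bar>2\<bar> \<le> 1\<close>, the absolute value is ultrametric, and every \<open>l\<close> with \<open>\<bar>l\<bar> = 1\<close> works. Either 2
    or 3 is such an exponent, since \<open>\<bar>2\<bar> < 1\<close> and \<open>\<bar>3\<bar> < 1\<close> would give \<open>\<bar>1\<bar> < 1\<close>.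

  A ball is uncountable, since countably many of its dilates cover a locally compact space
  without isolated points, whereas a field contains only countably many roots of unity. So some
  nonzero element of the ball around 1 is not a root of unity.\<close>

section \<open>Good heredity implies rootlessness\<close>

text \<open>Irreducible polynomials over a field are prime, so each factor \<open>q\<close> of a product \<open>R * S\<close> divides
  \<open>R\<close> or \<open>S\<close>. The degrees rule out \<open>R\<close>, so all factors cancel against \<open>S\<close> and nothing is left for \<open>R\<close>.\<close>

lemma dvd_prime_list_degree_less:
  fixes R :: "'a::field poly"
  assumes "\<And>q. q \<in> set qs \<Longrightarrow> Factorial_Ring.irreducible q \<and> Polynomial.degree R < Polynomial.degree q"
    and "R dvd prod_list qs"
  shows "is_unit R"
  using assms
proof (induction qs)
  case Nil
  then show ?case by simp
next
  case (Cons q qs)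
  from Cons.prems(2) obtain S where S: "q * prod_list qs = R * S"
    by (simp only: prod_list.Cons dvd_def) blast
  have irr: "Factorial_Ring.irreducible q" and deg: "Polynomial.degree R < Polynomial.degree q"
    using Cons.prems(1)[of q] by simp_all
  have q0: "q \<noteq> 0" using irr by auto
  have prime: "prime_elem q" using irr by (rule field_poly_irreducible_imp_prime)
  have "q dvd R * S" using S by (metis dvd_triv_left)
  hence "q dvd R \<or> q dvd S" using prime by (simp add: prime_elem_dvd_mult_iff)
  thus ?case
  proof
    assume "q dvd R"
    hence "R = 0" using deg dvd_imp_degree_le[of q R] by (cases "R = 0") simp_all
    hence "q * prod_list qs = 0" using S by simp
    hence "prod_list qs = 0" using q0 by simp
    hence "0 \<in> set qs" by (simp add: prod_list_zero_iff)
    thus ?thesis using Cons.prems(1)[of 0] by simp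
  next
    assume "q dvd S"
    then obtain S' where "S = q * S'" by (rule dvdE)
    hence "q * prod_list qs = q * (R * S')" using S by (simp add: algebra_simps)
    hence "prod_list qs = R * S'" using q0 by simp
    hence "R dvd prod_list qs" by simp
    thus ?thesis using Cons.IH Cons.prems(1) by simp
  qed
qed

text \<open>The exponents are bounded by any \<open>n\<close> for which the given polynomial in \<open>x\<^sup>n\<close> is a product of
  hereditarily irreducible factors: substituting \<open>x\<^sup>m\<close> keeps these irreducible and multiplies their
  degrees by \<open>m\<close>, but a solution of \<open>b\<^sup>m = a\<close> produces the divisor \<open>x\<^sup>n - b\<close> of degree only \<open>n\<close>.\<close>

lemma good_heredity_poly_linear_imp_finite_roots:
  fixes a :: "'a::field"
  assumes "good_heredity_poly [:- a, 1:]"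
  shows "finite {m::nat. m \<ge> 1 \<and> (\<exists>b. b ^ m = a)}"
proof -
  obtain n c qs where n: "n \<ge> 1" and c: "c \<noteq> 0"
    and her: "\<And>q. q \<in> set qs \<Longrightarrow> hereditarily_irreducible q"
    and eq: "pcompose [:- a, 1:] (Polynomial.monom 1 n) = Polynomial.smult c (prod_list qs)"
    using assms unfolding good_heredity_poly_def by blast
  have "m \<le> n" if m: "m \<ge> 1" and b: "b ^ m = a" for m b
  proof (rule ccontr)
    assume "\<not> m \<le> n"
    hence nm: "n < m" by simp
    (* x^n - b is too small to be divisible by any of the factors q(x^m) that its multiple
       x^(n m) - a decomposes into. *)
    define Y where "Y = (Polynomial.monom 1 m :: 'a poly)"
    define R where "R = Polynomial.monom 1 n - [:b:]"
    have degR: "Polynomial.degree R = n"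
    proof -
      have "Polynomial.degree (- [:b:]) < Polynomial.degree (Polynomial.monom (1::'a) n)"
        using n by (simp add: Polynomial.degree_monom_eq)
      from degree_add_eq_left[OF this] show ?thesis
        by (simp add: R_def Polynomial.degree_monom_eq del: minus_pCons flip: diff_conv_add_uminus)
    qed
    have prod: "pcompose (prod_list rs) Y = prod_list (map (\<lambda>q. pcompose q Y) rs)" for rs
      by (induction rs) (auto simp: pcompose_mult pcompose_1)
    have pow: "pcompose (q ^ k) Y = pcompose q Y ^ k" for q k
      by (induction k) (auto simp: pcompose_mult pcompose_1)
    have "R dvd Polynomial.monom 1 n ^ m - [:b:] ^ m"
    proof -
      have "x - y dvd x ^ m - y ^ m" for x y :: "'a poly"
        using m diff_power_eq_sum[of x "m - 1" y] by simp
      thus ?thesis unfolding R_def .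
    qed
    also have "Polynomial.monom 1 n ^ m - [:b:] ^ m = pcompose (pcompose [:- a, 1:] (Polynomial.monom 1 n)) Y"
    proof -
      have "(Polynomial.monom 1 n :: 'a poly) = [:0, 1:] ^ n" by (simp add: monom_altdef)
      hence "pcompose (Polynomial.monom 1 n) Y = Y ^ n" by (simp add: pow pcompose_pCons)
      also have "\<dots> = Polynomial.monom 1 n ^ m" by (simp add: Y_def monom_power mult.commute)
      finally have "pcompose (Polynomial.monom 1 n) Y = Polynomial.monom 1 n ^ m" .
      moreover have "pcompose [:- a, 1:] (Polynomial.monom 1 n) = Polynomial.monom 1 n - [:a:]"
        by (simp add: pcompose_pCons)
      ultimately show ?thesis using b by (simp add: pcompose_diff poly_const_pow)
    qed
    also have "\<dots> = Polynomial.smult c (prod_list (map (\<lambda>q. pcompose q Y) qs))"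
      by (simp add: eq pcompose_smult prod)
    finally have "R dvd prod_list (map (\<lambda>q. pcompose q Y) qs)"
      using c by (simp add: dvd_smult_iff)
    moreover have "Factorial_Ring.irreducible q \<and> Polynomial.degree R < Polynomial.degree q"
      if q: "q \<in> set (map (\<lambda>q. pcompose q Y) qs)" for q
    proof -
      obtain p where p: "p \<in> set qs" "q = pcompose p Y" using q by auto
      have "Factorial_Ring.irreducible (pcompose p (Polynomial.monom 1 k))" if "k \<ge> 1" for k
        using her[OF p(1)] that by (simp add: hereditarily_irreducible_def)
      from this[OF m] have irr: "Factorial_Ring.irreducible q" by (simp add: p Y_def)
      hence "Polynomial.degree q \<noteq> 0"
        using is_unit_iff_degree[of q] by (auto simp: Factorial_Ring.irreducible_def)
      moreover have "Polynomial.degree q = Polynomial.degree p * m"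
        by (simp add: p degree_pcompose Y_def Polynomial.degree_monom_eq)
      ultimately have "m \<le> Polynomial.degree q" by simp
      with irr nm degR show ?thesis by simp
    qed
    ultimately have "is_unit R" by (rule dvd_prime_list_degree_less[rotated])
    moreover have "R \<noteq> 0" using degR n by auto
    ultimately show False using degR n is_unit_iff_degree[of R] by simp
  qed
  hence "{m::nat. m \<ge> 1 \<and> (\<exists>b. b ^ m = a)} \<subseteq> {..n}" by auto
  thus ?thesis by (rule finite_subset) simp
qed

lemma good_heredity_imp_rootless:
  assumes "good_heredity_field TYPE('a::field)"
  shows "rootless_field TYPE('a)"
  unfolding rootless_field_def
proof (intro allI impI)
  fix a :: 'a
  assume a: "a \<noteq> 0 \<and> \<not> root_of_unity a"
  have "z \<noteq> 0 \<and> \<not> root_of_unity z"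
    if "poly (map_poly to_ac [:- a, 1:]) z = 0" for z :: "'a alg_closure"
  proof -
    have "z = to_ac a" using that by (simp add: map_poly_pCons)
    moreover have "to_ac a ^ n = 1 \<longleftrightarrow> a ^ n = 1" for n
      by (metis to_ac_1 to_ac_eq_iff to_ac_power)
    ultimately show ?thesis using a by (auto simp: root_of_unity_def)
  qed
  hence "good_heredity_poly [:- a, 1:]"
    using assms unfolding good_heredity_field_def by blast
  from good_heredity_poly_linear_imp_finite_roots[OF this] a show "rootless a"
    by (simp add: rootless_def)
qed

section \<open>Countability, growth and contractions\<close>

lemma countable_roots_of_unity: "countable {a::'a::field. root_of_unity a}"
proof -
  have "finite {a::'a. a ^ n = 1}" if "n \<ge> 1" for n :: nat
  proof -
    have "Polynomial.coeff (Polynomial.monom (1::'a) n - 1) n \<noteq> 0" using that by simp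
    hence "Polynomial.monom (1::'a) n - 1 \<noteq> 0" by (metis coeff_0)
    from poly_roots_finite[OF this] show ?thesis by (simp add: poly_monom)
  qed
  hence "countable (\<Union>n\<in>{1::nat..}. {a::'a. a ^ n = 1})"
    by (intro countable_UN) (auto intro: countable_finite)
  also have "(\<Union>n\<in>{1::nat..}. {a::'a. a ^ n = 1}) = {a. root_of_unity a}"
    by (auto simp: root_of_unity_def)
  finally show ?thesis .
qed

text \<open>This is how estimates with a loss linear in the exponent become sharp: applied to all powers
  of an element, the loss disappears.\<close>

lemma le_1_if_powers_grow_linearly:
  fixes c A :: real
  assumes "\<And>j::nat. c ^ j \<le> A * (real j + 1)"
  shows "c \<le> 1"
proof (rule ccontr)
  assume "\<not> c \<le> 1"
  hence c: "c > 1" by simp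
  have "(\<lambda>j. A * (real j / c ^ j + (1 / c) ^ j)) \<longlonglongrightarrow> A * (0 + 0)"
    using c by (intro tendsto_intros LIMSEQ_power_zero lim_n_over_pown) auto
  moreover have "1 \<le> A * (real j / c ^ j + (1 / c) ^ j)" for j
    using assms[of j] c by (simp add: field_simps)
  ultimately have "1 \<le> A * (0 + 0)" by (intro LIMSEQ_le_const) auto
  thus False by simp
qed

text \<open>Along the iteration the distance from a point to its
  image decays geometrically, so the limit of a convergent subsequence is not moved at all.\<close>

lemma (in Metric_space) contraction_on_compact_has_fixpoint:
  assumes K: "compactin mtopology K" "K \<noteq> {}"
    and f: "f \<in> K \<rightarrow> K"
    and k: "0 \<le> k" "k < 1"
    and contr: "\<And>x y. x \<in> K \<Longrightarrow> y \<in> K \<Longrightarrow> d (f x) (f y) \<le> k * d x y"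
  shows "\<exists>x\<in>K. f x = x"
proof -
  obtain a where a: "a \<in> K" using K by auto
  define s where "s n = (f ^^ n) a" for n
  have KM: "K \<subseteq> M" using compactin_subset_topspace[OF K(1)] by simp
  have s: "s n \<in> K" for n by (induction n) (use a f in \<open>auto simp: s_def\<close>)
  have sM: "s n \<in> M" for n using s KM by auto
  have step: "d (s n) (f (s n)) \<le> k ^ n * d a (f a)" for n
  proof (induction n)
    case 0
    then show ?case by (simp add: s_def)
  next
    case (Suc n)
    have "d (s (Suc n)) (f (s (Suc n))) = d (f (s n)) (f (f (s n)))" by (simp add: s_def)
    also have "\<dots> \<le> k * d (s n) (f (s n))" using contr s f by blast
    also have "\<dots> \<le> k * (k ^ n * d a (f a))" using Suc k by (intro mult_left_mono) auto
    finally show ?case by simp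
  qed
  obtain l r where l: "l \<in> K" and r: "strict_mono r" and lim: "limitin mtopology (s \<circ> r) l sequentially"
    using K(1) s unfolding compactin_sequentially by (metis image_subset_iff)
  have lM: "l \<in> M" and flM: "f l \<in> M" using l f KM by auto
  have lim0: "(\<lambda>n. d (s (r n)) l) \<longlonglongrightarrow> 0"
    using lim by (simp add: limitin_metric_dist_null o_def)
  have "(\<lambda>n. k ^ r n) \<longlonglongrightarrow> 0"
    using LIMSEQ_subseq_LIMSEQ[OF LIMSEQ_power_zero r, of k] k by (simp add: o_def)
  hence "(\<lambda>n. d (s (r n)) l + k ^ r n * d a (f a) + k * d (s (r n)) l) \<longlonglongrightarrow> 0 + 0 * d a (f a) + k * 0"
    using lim0 by (intro tendsto_intros)
  moreover have "d l (f l) \<le> d (s (r n)) l + k ^ r n * d a (f a) + k * d (s (r n)) l" for n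
  proof -
    let ?x = "s (r n)"
    have fx: "f ?x \<in> M" using s f KM by auto
    have "d l (f l) \<le> d l ?x + d ?x (f l)" using triangle lM flM sM by blast
    also have "d ?x (f l) \<le> d ?x (f ?x) + d (f ?x) (f l)" using triangle sM flM fx by blast
    finally show ?thesis using step[of "r n"] contr[OF s l, of "r n"] by (simp add: commute)
  qed
  ultimately have "d l (f l) \<le> 0 + 0 * d a (f a) + k * 0"
    by (intro LIMSEQ_le_const) auto
  hence "d l (f l) = 0" using nonneg[of l "f l"] by simp
  thus ?thesis using l lM flM by (metis zero)
qed


section \<open>Absolute values bounded by 1 on the integers are ultrametric\<close>

context absolute_value
begin

interpretation M: Metric_space UNIV "\<lambda>x y. v (x - y)"
  by (rule Metric_space_absolute_value)

lemma v_0 [simp]: "v 0 = 0" by (simp add: eq_0_iff)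

lemma v_1 [simp]: "v 1 = 1"
  using mult[of 1 1] eq_0_iff[of 1] by simp

lemma v_diff_commute: "v (x - y) = v (y - x)"
  by (rule M.commute)

lemma v_minus [simp]: "v (- x) = v x"
  using v_diff_commute[of 0 x] by simp

lemma v_diff_le: "v (x - y) \<le> v x + v y"
  using triangle[of x "- y"] by simp

lemma v_pos: "x \<noteq> 0 \<Longrightarrow> v x > 0"
  using nonneg[of x] eq_0_iff[of x] by simp

lemma v_power: "v (x ^ n) = v x ^ n"
  by (induction n) (simp_all add: mult)

lemma v_divide: "v (x / y) = v x / v y"
proof (cases "y = 0")
  case False
  have "v (x / y) * v y = v x" using False by (simp flip: mult)
  thus ?thesis using v_pos[OF False] by (simp add: field_simps)
qed simp

lemma v_sum_le: "v (\<Sum>i\<in>A. f i) \<le> (\<Sum>i\<in>A. v (f i))"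
proof (induction A rule: infinite_finite_induct)
  case (insert i A)
  thus ?case using triangle[of "f i" "sum f A"] by simp
qed simp_all

text \<open>If the weights \<open>2\<^sup>i\<close> of the binary expansion have absolute value at most 1, only the number of
  digits counts in the triangle inequality.\<close>

lemma v_of_nat_le_binary_length:
  assumes "v 2 \<le> 1"
  shows "n < 2 ^ k \<Longrightarrow> v (of_nat n) \<le> real k"
proof (induction k arbitrary: n)
  case (Suc k)
  have "of_nat n = (of_nat (2 * (n div 2) + n mod 2) :: 'a)" by simp
  also have "\<dots> = 2 * of_nat (n div 2) + of_nat (n mod 2)" by (simp only: of_nat_add of_nat_mult of_nat_numeral)
  finally have "v (of_nat n) \<le> v 2 * v (of_nat (n div 2)) + v (of_nat (n mod 2))"
    using triangle[of "2 * of_nat (n div 2)" "of_nat (n mod 2)"] by (simp add: mult)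
  also have "v 2 * v (of_nat (n div 2)) \<le> 1 * v (of_nat (n div 2))"
    using assms nonneg by (intro mult_right_mono) auto
  also have "v (of_nat (n div 2)) \<le> real k" using Suc by (intro Suc.IH) auto
  also have "v (of_nat (n mod 2)) \<le> 1" by (cases "even n") (simp_all add: odd_iff_mod_2_eq_one)
  finally show ?case by simp
qed simp

text \<open>The number of binary digits of \<open>n\<^sup>j\<close> is linear in \<open>j\<close>, while \<open>\<bar>n\<^sup>j\<bar> = \<bar>n\<bar>\<^sup>j\<close>.\<close>

lemma v_of_nat_le_1:
  assumes "v 2 \<le> 1"
  shows "v (of_nat n) \<le> 1"
proof (rule le_1_if_powers_grow_linearly)
  fix j :: nat
  have "n ^ j \<le> (2 ^ n) ^ j" by (intro power_mono) (auto intro: less_imp_le)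
  also have "\<dots> < 2 ^ (n * j + 1)" by (simp add: power_mult)
  finally have "v (of_nat (n ^ j)) \<le> real (n * j + 1)"
    by (intro v_of_nat_le_binary_length assms)
  also have "\<dots> \<le> real (n + 1) * (real j + 1)" by (simp add: algebra_simps)
  finally show "v (of_nat n) ^ j \<le> real (n + 1) * (real j + 1)" by (simp add: v_power)
qed

text \<open>The binomial coefficients have absolute value at most 1, so the \<open>k + 1\<close> terms of the binomial
  expansion of \<open>(x + y)\<^sup>k\<close> are each bounded by the \<open>k\<close>-th power of the maximum.\<close>

lemma ultrametric:
  assumes "v 2 \<le> 1"
  shows "v (x + y) \<le> max (v x) (v y)"
proof -
  define m where "m = max (v x) (v y)"
  have m: "v x \<le> m" "v y \<le> m" "0 \<le> m" using nonneg[of x] by (auto simp: m_def)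
  show ?thesis
  proof (cases "m = 0")
    case True
    hence "x = 0" "y = 0" using m nonneg[of x] nonneg[of y] eq_0_iff by auto
    thus ?thesis by simp
  next
    case False
    with m have m0: "m > 0" by simp
    have "v (x + y) / m \<le> 1"
    proof (rule le_1_if_powers_grow_linearly)
      fix k :: nat
      have "v (x + y) ^ k = v (\<Sum>i\<le>k. of_nat (k choose i) * x ^ i * y ^ (k - i))"
        by (simp flip: v_power binomial_ring)
      also have "\<dots> \<le> (\<Sum>i\<le>k. v (of_nat (k choose i) * x ^ i * y ^ (k - i)))"
        by (rule v_sum_le)
      also have "\<dots> \<le> (\<Sum>i\<le>k. m ^ k)"
      proof (rule sum_mono)
        fix i assume i: "i \<in> {..k}"
        have "v (of_nat (k choose i) * x ^ i * y ^ (k - i)) \<le> 1 * m ^ i * m ^ (k - i)"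
          unfolding mult v_power using m nonneg v_of_nat_le_1[OF assms]
          by (intro mult_mono power_mono mult_nonneg_nonneg zero_le_power) auto
        thus "v (of_nat (k choose i) * x ^ i * y ^ (k - i)) \<le> m ^ k"
          using i by (simp flip: power_add)
      qed
      finally have "v (x + y) ^ k \<le> (real k + 1) * m ^ k" by (simp add: algebra_simps)
      thus "(v (x + y) / m) ^ k \<le> 1 * (real k + 1)"
        using m0 by (simp add: power_divide divide_le_eq)
    qed
    thus ?thesis using m0 by (simp add: divide_le_eq m_def)
  qed
qed

lemma ultrametric_le:
  assumes "v 2 \<le> 1" "v x \<le> r" "v y \<le> r"
  shows "v (x + y) \<le> r"
  using ultrametric[OF assms(1), of x y] assms(2,3) by simp

lemma ultrametric_sum_le:
  assumes "v 2 \<le> 1" "0 \<le> r" "\<And>i. i \<in> A \<Longrightarrow> v (f i) \<le> r"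
  shows "v (\<Sum>i\<in>A. f i) \<le> r"
  using assms(3)
  by (induction A rule: infinite_finite_induct) (use assms(1,2) in \<open>auto intro: ultrametric_le\<close>)

section \<open>Roots of elements near 1\<close>

lemma one_units_mult:
  assumes u: "v 2 \<le> 1" and r: "r \<le> 1" and "v (w - 1) \<le> r" "v (z - 1) \<le> r"
  shows "v (w * z - 1) \<le> r"
proof -
  have "v w \<le> 1" using ultrametric_le[OF u, of "w - 1" 1 1] assms by simp
  hence "v (w * (z - 1)) \<le> 1 * r"
    unfolding mult using assms nonneg by (intro mult_mono) auto
  with assms have "v (w * (z - 1) + (w - 1)) \<le> r" by (intro ultrametric_le) auto
  thus ?thesis by (simp add: algebra_simps)
qed

lemma one_units_power:
  assumes "v 2 \<le> 1" "r \<le> 1" "v (w - 1) \<le> r"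
  shows "v (w ^ n - 1) \<le> r"
proof (induction n)
  case 0
  have "0 \<le> r" using nonneg[of "w - 1"] assms(3) by linarith
  thus ?case by simp
next
  case (Suc n)
  thus ?case using one_units_mult[of r w "w ^ n"] assms by simp
qed

text \<open>The deviation of \<open>(1 + y)\<^sup>l\<close> from its linear approximation at \<open>y = 0\<close>.\<close>

definition power_error :: "nat \<Rightarrow> 'a \<Rightarrow> 'a" where
  "power_error l y = (1 + y) ^ l - 1 - of_nat l * y"

text \<open>The equation \<open>(1 + y)\<^sup>l = 1 + x\<close> says that \<open>y\<close> is a fixed point of
  \<open>y \<mapsto> (x - power_error l y) / l\<close>. The hypotheses state that this map is a contraction of the ball
  with factor \<open>k\<close>, and that it maps the ball to itself.\<close>

lemma root_near_1:
  assumes K: "compactin M.mtopology {y. v y \<le> \<rho>}" and \<rho>: "0 \<le> \<rho>"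
    and l: "of_nat l \<noteq> (0 :: 'a)" and k: "0 \<le> k" "k < 1"
    and contr: "\<And>y z. v y \<le> \<rho> \<Longrightarrow> v z \<le> \<rho> \<Longrightarrow>
      v (power_error l y - power_error l z) \<le> k * v (of_nat l) * v (y - z)"
    and self: "\<And>x y. v x \<le> \<rho> \<Longrightarrow> v y \<le> \<rho> \<Longrightarrow> v (x - power_error l y) \<le> v (of_nat l) * \<rho>"
    and x: "v x \<le> \<rho>"
  shows "\<exists>y. v y \<le> \<rho> \<and> (1 + y) ^ l = 1 + x"
proof -
  define g where "g y = (x - power_error l y) / of_nat l" for y
  have vl: "v (of_nat l) > 0" using l by (rule v_pos)
  have "\<exists>y\<in>{y. v y \<le> \<rho>}. g y = y"
  proof (rule M.contraction_on_compact_has_fixpoint[OF K _ _ k])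
    show "{y. v y \<le> \<rho>} \<noteq> {}" using \<rho> by (auto intro!: exI[of _ 0])
    show "g \<in> {y. v y \<le> \<rho>} \<rightarrow> {y. v y \<le> \<rho>}"
      using self[OF x] vl by (auto simp: g_def v_divide divide_le_eq mult.commute)
    fix y z assume "y \<in> {y. v y \<le> \<rho>}" "z \<in> {y. v y \<le> \<rho>}"
    moreover have "g y - g z = (power_error l z - power_error l y) / of_nat l"
      by (simp add: g_def flip: diff_divide_distrib)
    ultimately show "v (g y - g z) \<le> k * v (y - z)"
      using contr[of z y] vl by (simp add: v_divide divide_le_eq mult_ac v_diff_commute)
  qed
  then obtain y where y: "v y \<le> \<rho>" "g y = y" by auto
  hence "x - power_error l y = of_nat l * y" using l by (simp add: g_def field_simps)
  hence "(1 + y) ^ l = 1 + x" by (simp add: power_error_def algebra_simps)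
  with y show ?thesis by blast
qed

lemma power_error_2: "power_error 2 y = y ^ 2"
  by (simp add: power_error_def power2_eq_square algebra_simps)

text \<open>The error is \<open>y\<^sup>2\<close>. It maps the ball into one of radius \<open>\<rho>\<^sup>2\<close>, so stability of the ball requires
  \<open>\<rho> + \<rho>\<^sup>2 \<le> \<bar>2\<bar> \<rho>\<close>, that is \<open>\<rho> \<le> \<bar>2\<bar> - 1\<close>. The contraction factor is \<open>2\<rho> / \<bar>2\<bar>\<close>, where the first 2
  is a real number, and half of that radius makes it less than 1.\<close>

lemma square_root_near_1_archimedean:
  assumes c: "v 2 > 1" and \<rho>: "0 \<le> \<rho>" "\<rho> \<le> (v 2 - 1) / 2"
    and K: "compactin M.mtopology {y. v y \<le> \<rho>}" and x: "v x \<le> \<rho>"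
  shows "\<exists>y. v y \<le> \<rho> \<and> (1 + y) ^ 2 = 1 + x"
proof (rule root_near_1[OF K \<rho>(1) _ _ _ _ _ x])
  have "(2::'a) \<noteq> 0" using c by auto
  thus "of_nat 2 \<noteq> (0::'a)" by simp
  show "0 \<le> 2 * \<rho> / v 2" "2 * \<rho> / v 2 < 1" using c \<rho> by (auto simp: field_simps)
next
  fix y z assume yz: "v y \<le> \<rho>" "v z \<le> \<rho>"
  have "v (y ^ 2 - z ^ 2) = v (y + z) * v (y - z)"
    by (simp add: power2_eq_square square_diff_square_factored mult)
  also have "\<dots> \<le> (2 * \<rho>) * v (y - z)"
    using triangle[of y z] yz nonneg by (intro mult_right_mono) auto
  finally show "v (power_error 2 y - power_error 2 z) \<le> 2 * \<rho> / v 2 * v (of_nat 2) * v (y - z)"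
    using c by (simp add: power_error_2)
next
  fix x y assume xy: "v x \<le> \<rho>" "v y \<le> \<rho>"
  have "v (x - y ^ 2) \<le> v x + v y ^ 2" using v_diff_le[of x "y ^ 2"] by (simp add: v_power)
  also have "\<dots> \<le> \<rho> + \<rho> * \<rho>"
    unfolding power2_eq_square using xy nonneg \<rho> by (intro add_mono mult_mono) auto
  also have "\<dots> = (1 + \<rho>) * \<rho>" by (simp add: algebra_simps)
  also have "\<dots> \<le> v 2 * \<rho>" using c \<rho> by (intro mult_right_mono) auto
  finally show "v (x - power_error 2 y) \<le> v (of_nat 2) * \<rho>" by (simp add: power_error_2)
qed

text \<open>The difference of the two \<open>l\<close>-th powers is \<open>y - z\<close> times a sum of \<open>l\<close> products of elements of
  \<open>1 + B\<close>, where \<open>B\<close> is the ball of radius \<open>\<rho>\<close>. By the ultrametric inequality \<open>1 + B\<close> is closed under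
  products, so the sum differs from \<open>l\<close> by an element of \<open>B\<close>.\<close>

lemma power_error_lipschitz_ultrametric:
  assumes u: "v 2 \<le> 1" and \<rho>: "0 \<le> \<rho>" "\<rho> \<le> 1" and yz: "v y \<le> \<rho>" "v z \<le> \<rho>"
  shows "v (power_error l y - power_error l z) \<le> \<rho> * v (y - z)"
proof (cases l)
  case 0
  thus ?thesis using \<rho> nonneg by (simp add: power_error_def)
next
  case (Suc n)
  define S where "S = (\<Sum>p<Suc n. (1 + y) ^ p * (1 + z) ^ (n - p) - 1)"
  have "(1 + y) ^ l - (1 + z) ^ l = (y - z) * (\<Sum>p<Suc n. (1 + y) ^ p * (1 + z) ^ (n - p))"
    using diff_power_eq_sum[of "1 + y" n "1 + z"] by (simp only: Suc add_diff_cancel_left)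
  also have "(\<Sum>p<Suc n. (1 + y) ^ p * (1 + z) ^ (n - p)) = S + of_nat l"
    by (simp only: S_def sum_subtractf) (simp add: Suc)
  finally have "power_error l y - power_error l z = (y - z) * S"
    by (simp add: power_error_def algebra_simps)
  moreover have "v S \<le> \<rho>"
    unfolding S_def using yz \<rho> u
    by (intro ultrametric_sum_le one_units_mult one_units_power) auto
  ultimately show ?thesis
    using mult_left_mono[of "v S" \<rho> "v (y - z)"] nonneg[of "y - z"] by (simp add: mult mult.commute)
qed

text \<open>Division by \<open>l\<close> preserves the absolute value, so the contraction factor is \<open>\<rho>\<close> itself. As the
  error vanishes at 0, the same Lipschitz bound shows that the ball is mapped to itself.\<close>

lemma root_near_1_ultrametric:
  assumes u: "v 2 \<le> 1" and l: "v (of_nat l) = 1" and \<rho>: "0 \<le> \<rho>" "\<rho> < 1"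
    and K: "compactin M.mtopology {y. v y \<le> \<rho>}" and x: "v x \<le> \<rho>"
  shows "\<exists>y. v y \<le> \<rho> \<and> (1 + y) ^ l = 1 + x"
proof (rule root_near_1[OF K \<rho>(1) _ \<rho> _ _ x])
  show "of_nat l \<noteq> (0::'a)" using l by auto
next
  fix y z assume "v y \<le> \<rho>" "v z \<le> \<rho>"
  thus "v (power_error l y - power_error l z) \<le> \<rho> * v (of_nat l) * v (y - z)"
    using power_error_lipschitz_ultrametric[OF u \<rho>(1)] \<rho> l by simp
next
  fix x y assume xy: "v x \<le> \<rho>" "v y \<le> \<rho>"
  have "v (power_error l y - power_error l 0) \<le> \<rho> * v (y - 0)"
    using xy \<rho> by (intro power_error_lipschitz_ultrametric u) auto
  also have "\<rho> * v (y - 0) \<le> 1 * \<rho>" using xy \<rho> nonneg by (intro mult_mono) auto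
  finally have "v (- power_error l y) \<le> \<rho>" by (simp add: power_error_def[of l 0])
  from ultrametric_le[OF u xy(1) this]
  show "v (x - power_error l y) \<le> v (of_nat l) * \<rho>" using l by simp
qed

end

section \<open>Local fields are not rootless\<close>

context local_field
begin

interpretation M: Metric_space UNIV "\<lambda>x y. v (x - y)"
  by (rule Metric_space_absolute_value)

lemma ex_small: "\<exists>t. t \<noteq> 0 \<and> v t < 1"
proof -
  obtain x where x: "x \<noteq> 0" "v x \<noteq> 1" using nontrivial by auto
  show ?thesis
  proof (cases "v x < 1")
    case False
    hence "v (1 / x) < 1" using x by (simp add: v_divide)
    thus ?thesis using x by (intro exI[of _ "1 / x"]) auto
  qed (use x in auto)
qed

lemma small_power:
  assumes "v t < 1" "0 < r"
  shows "\<exists>n. v x * v t ^ n < r"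
proof -
  have "(\<lambda>n. v x * v t ^ n) \<longlonglongrightarrow> v x * 0"
    using assms nonneg by (intro tendsto_intros LIMSEQ_power_zero) auto
  hence "(\<lambda>n. v x * v t ^ n) \<longlonglongrightarrow> 0" by simp
  from order_tendstoD(2)[OF this assms(2)] show ?thesis
    by (auto simp: eventually_sequentially)
qed

lemma ex_compact_ball: "\<exists>e>0. \<forall>\<rho>\<le>e. compactin M.mtopology {y. v y \<le> \<rho>}"
proof -
  obtain U K where UK: "openin M.mtopology U" "compactin M.mtopology K" "0 \<in> U" "U \<subseteq> K"
    using locally_compact unfolding locally_compact_space_def by (metis M.topspace_mtopology UNIV_I)
  obtain r where r: "r > 0" "M.mball 0 r \<subseteq> U"
    using UK(1,3) unfolding M.openin_mtopology by blast
  have "compactin M.mtopology {y. v y \<le> \<rho>}" if "\<rho> \<le> r / 2" for \<rho>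
  proof -
    have ball: "{y. v y \<le> \<rho>} = M.mcball 0 \<rho>" by auto
    have "M.mcball 0 \<rho> \<subseteq> M.mball 0 r" using that r by auto
    with r UK have "{y. v y \<le> \<rho>} \<subseteq> K" unfolding ball by blast
    moreover have "closedin M.mtopology {y. v y \<le> \<rho>}" unfolding ball by simp
    ultimately show ?thesis using UK(2) closed_compactin by blast
  qed
  thus ?thesis using r by (intro exI[of _ "r / 2"]) auto
qed

lemma ex_exponent_with_roots_near_1:
  "\<exists>l \<rho>. 2 \<le> (l::nat) \<and> 0 < \<rho> \<and> (\<forall>x. v x \<le> \<rho> \<longrightarrow> (\<exists>y. v y \<le> \<rho> \<and> (1 + y) ^ l = 1 + x))"
proof -
  obtain e where e: "e > 0" "\<And>\<rho>. \<rho> \<le> e \<Longrightarrow> compactin M.mtopology {y. v y \<le> \<rho>}"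
    using ex_compact_ball by blast
  show ?thesis
  proof (cases "v 2 > 1")
    case True
    then obtain \<rho> where "0 < \<rho>" "\<rho> < e" "\<rho> < (v 2 - 1) / 2"
      using field_lbound_gt_zero[of e "(v 2 - 1) / 2"] e(1) by auto
    hence \<rho>: "0 < \<rho>" "\<rho> \<le> e" "\<rho> \<le> (v 2 - 1) / 2" by simp_all
    have "\<forall>x. v x \<le> \<rho> \<longrightarrow> (\<exists>y. v y \<le> \<rho> \<and> (1 + y) ^ 2 = 1 + x)"
      using square_root_near_1_archimedean[OF True _ \<rho>(3) e(2)[OF \<rho>(2)]] \<rho>(1) by simp
    with \<rho>(1) show ?thesis by (intro exI[of _ "2::nat"] exI[of _ \<rho>]) simp
  next
    case False
    hence u: "v 2 \<le> 1" by simp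
    have "\<exists>l\<ge>2::nat. v (of_nat l) = 1"
    proof (cases "v 2 = 1")
      case True
      thus ?thesis by (intro exI[of _ 2]) auto
    next
      case False
      have "v (3 + (- 2)) \<le> max (v 3) (v 2)" using ultrametric[OF u, of 3 "- 2"] by simp
      hence "v 3 \<ge> 1" using u False by simp
      moreover have "v 3 \<le> 1" using v_of_nat_le_1[OF u, of 3] by simp
      ultimately show ?thesis by (intro exI[of _ 3]) auto
    qed
    then obtain l :: nat where l: "l \<ge> 2" "v (of_nat l) = 1" by blast
    define \<rho> where "\<rho> = min e (1 / 2)"
    have \<rho>: "0 < \<rho>" "\<rho> \<le> e" "\<rho> < 1" using e(1) by (auto simp: \<rho>_def)
    have "\<forall>x. v x \<le> \<rho> \<longrightarrow> (\<exists>y. v y \<le> \<rho> \<and> (1 + y) ^ l = 1 + x)"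
      using root_near_1_ultrametric[OF u l(2) _ \<rho>(3) e(2)[OF \<rho>(2)]] \<rho>(1) by simp
    with \<rho>(1) l(1) show ?thesis by (intro exI[of _ l] exI[of _ \<rho>]) simp
  qed
qed

text \<open>Every element of the field is carried into the ball by a power of a fixed small element, so
  the field is a countable union of dilates of the ball. The field itself is uncountable: it is
  locally compact, and powers of the small element accumulate at 0, so that no point is
  isolated.\<close>

lemma uncountable_ball:
  assumes "0 < \<rho>"
  shows "uncountable {x. v x \<le> \<rho>}"
proof
  assume B: "countable {x. v x \<le> \<rho>}"
  obtain t where t: "t \<noteq> 0" "v t < 1" using ex_small by blast
  have "x \<in> (\<Union>n. (\<lambda>b. b / t ^ n) ` {x. v x \<le> \<rho>})" for x
  proof -
    obtain n where "v x * v t ^ n < \<rho>" using small_power[OF t(2) assms] by blast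
    hence "x * t ^ n \<in> {x. v x \<le> \<rho>}" by (simp add: mult v_power)
    moreover have "x = x * t ^ n / t ^ n" using t by simp
    ultimately show ?thesis by blast
  qed
  hence "UNIV = (\<Union>n. (\<lambda>b. b / t ^ n) ` {x. v x \<le> \<rho>})" by (rule UNIV_eq_I)
  moreover have "countable (\<Union>n. (\<lambda>b. b / t ^ n) ` {x. v x \<le> \<rho>})" using B by simp
  ultimately have "countable (UNIV :: 'a set)" by simp
  moreover have "M.mtopology derived_set_of UNIV = UNIV"
  proof -
    have "\<exists>y. y \<noteq> x \<and> v (x - y) < r" if r: "0 < r" for x r
    proof -
      obtain n where "v 1 * v t ^ n < r" using small_power[OF t(2) r] by blast
      thus ?thesis using t by (intro exI[of _ "x + t ^ n"]) (auto simp: v_power)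
    qed
    thus ?thesis by (auto simp: M.metric_derived_set_of)
  qed
  hence "(UNIV :: real set) \<lesssim> (UNIV :: 'a set)"
    using locally_compact M.Hausdorff_space_mtopology by (intro lepoll_perfect_set) auto
  ultimately show False using countable_lepoll uncountable_UNIV_real by blast
qed

text \<open>Since the roots given by the previous results stay in the ball, they can be iterated: each
  element of \<open>1 + B\<close>, with \<open>B\<close> the ball, is an \<open>l\<^sup>k\<close>-th power for all \<open>k\<close>. The uncountable set \<open>1 + B\<close>
  contains an element that is neither 0 nor a root of unity.\<close>

lemma not_rootless_field: "\<not> rootless_field TYPE('a)"
proof -
  obtain l :: nat and \<rho> where l: "2 \<le> l" and \<rho>: "0 < \<rho>"
    and root: "\<And>x. v x \<le> \<rho> \<Longrightarrow> \<exists>y. v y \<le> \<rho> \<and> (1 + y) ^ l = 1 + x"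
    using ex_exponent_with_roots_near_1 by blast
  have "countable ((\<lambda>a. a - 1) ` insert 0 {a::'a. root_of_unity a})"
    using countable_roots_of_unity by auto
  hence "\<not> {x. v x \<le> \<rho>} \<subseteq> (\<lambda>a. a - 1) ` insert 0 {a::'a. root_of_unity a}"
    using uncountable_ball[OF \<rho>] countable_subset by blast
  then obtain x where x: "v x \<le> \<rho>" and xn: "x \<notin> (\<lambda>a. a - 1) ` insert 0 {a::'a. root_of_unity a}"
    by blast
  have "1 + x \<notin> insert 0 {a. root_of_unity a}"
    using xn by (metis add_diff_cancel_left' image_eqI)
  hence a: "1 + x \<noteq> 0" "\<not> root_of_unity (1 + x)" by auto
  have "\<exists>y. v y \<le> \<rho> \<and> (1 + y) ^ (l ^ k) = 1 + x" for k
  proof (induction k)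
    case 0
    thus ?case using x by auto
  next
    case (Suc k)
    then obtain y where y: "v y \<le> \<rho>" "(1 + y) ^ (l ^ k) = 1 + x" by blast
    from root[OF y(1)] obtain z where "v z \<le> \<rho>" "(1 + z) ^ l = 1 + y" by blast
    with y show ?case by (intro exI[of _ z]) (simp add: power_mult)
  qed
  hence "range (\<lambda>k. l ^ k) \<subseteq> {n. n \<ge> 1 \<and> (\<exists>b. b ^ n = 1 + x)}"
    using l by fastforce
  moreover have "infinite (range (\<lambda>k. l ^ k))"
    using l by (intro range_inj_infinite injI) (simp add: power_inject_exp)
  ultimately have "infinite {n. n \<ge> 1 \<and> (\<exists>b. b ^ n = 1 + x)}"
    by (rule infinite_super)
  with a show ?thesis unfolding rootless_field_def rootless_def by blast
qed

end

theorem corollary34: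
  fixes v :: "'a::field \<Rightarrow> real"
  assumes "local_field v"
  shows "\<not> rootless_field TYPE('a) \<and> \<not> good_heredity_field TYPE('a)"
  using local_field.not_rootless_field[OF assms] good_heredity_imp_rootless by blast

end
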